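(* Let $v(\sigma,t)$ be a sufficiently smooth real function on $\mathbb{R}\times[0,T]$, $2\pi$-periodic in $\sigma$, with $\int_0^{2\pi}v(\sigma,t)\,d\sigma=0$, satisfying $$\frac{\partial v}{\partial t}+\frac{\delta}{R^4}\frac{\partial^4v}{\partial\sigma^4}+\frac1{R^2}\Big(\alpha-1+\frac{\delta}{R^2}\Big)\frac{\partial^2v}{\partial\sigma^2}+\frac{\alpha-1}{R^2}v-\frac{v_c}{R^2}v\frac{\partial v}{\partial\sigma}=0,\qquad R=R(t),$$ and let $M>0$ be a constant with $\sup_{0\le t\le T}\|\partial v/\partial\sigma(\cdot,t)\|_\infty\le M$. Let $\boldsymbol v^0\in\mathbb{R}^J_{\mathrm{per}}$, $v^0_i=v(\sigma_i,0)$. Then for all sufficiently small $kh^{-1/5}$ (i.e. there is $\varepsilon>0$ such that whenever $kh^{-1/5}\le\varepsilon$) the solution of the Crank--Nicolson scheme is unique: if $(\boldsymbol V^n)_{0\le n\le N}$ and $(\boldsymbol W^n)_{0\le n\le N}$ in $\mathbb{R}^J_{\mathrm{per}}$ both start from $\boldsymbol V^0=\boldsymbol W^0=\boldsymbol v^0$ and both satisfy $$\frac1k(\boldsymbol V^{n+1}-\boldsymbol V^n)+\mathcal L_h^{n+\frac12}\boldsymbol V^{n+\frac12}=\frac{v_c}{6hR_{n+\frac12}^2}\boldsymbol\varphi(\boldsymbol V^{n+\frac12},\boldsymbol V^{n+\frac12}),\qquad n=0,\dots,N-1,$$ where $\boldsymbol V^{n+\frac12}=\frac12(\boldsymbol V^n+\boldsymbol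 V^{n+1})$ (and likewise for $\boldsymbol W$), then $\boldsymbol V^n=\boldsymbol W^n$ for all $n=0,\dots,N$.
   Context: Constants and radius: $\delta>0$, $\alpha>0$, $v_c\in\mathbb{R}$, $T>0$ are fixed. $R:[0,T]\to(0,\infty)$ is a given solution of $\dot R=v_c+(\alpha-1)/R$, $R(0)=R_0>0$, which is expanding ($\dot R>0$). Grid: $J,N\in\mathbb{N}$, $h=2\pi/J$, $\sigma_i=ih$ ($i\in\mathbb{Z}$), $k=T/N$, $t^n=nk$; $R_m=R(mk)$ for integer or half-integer $m$. $\mathbb{R}^J_{\mathrm{per}}=\{\boldsymbol V=(V_i)_{i\in\mathbb{Z}}: V_i\in\mathbb{R},\ V_{i+J}=V_i\}$. For $\boldsymbol V,\boldsymbol W\in\mathbb{R}^J_{\mathrm{per}}$: $\Delta_hV_i=h^{-2}(V_{i-1}-2V_i+V_{i+1})$, $\Delta_h^2V_i=h^{-2}(\Delta_hV_{i-1}-2\Delta_hV_i+\Delta_hV_{i+1})$, $$(\mathcal L_h^m\boldsymbol V)_i=\frac{\delta}{R_m^4}\Delta_h^2V_i+\frac1{R_m^2}\Big(\alpha-1+\frac{\delta}{R_m^2}\Big)\Delta_hV_i+\frac{\alpha-1}{R_m^2}V_i,$$ $$(\boldsymbol\varphi(\boldsymbol V,\boldsymbol W))_i=(V_{i-1}+V_i+V_{i+1})(W_{i+1}-W_{i-1}).$$ Standing assumption: the grid initial data have zero discrete mean, $h\sum_{i=1}^Jv^0_i=0$. The data $\delta,\alpha,v_c,T,R,v,M$ are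 fixed before the smallness threshold is chosen. *)

theory Defs
  imports "HOL-Analysis.Analysis"
begin

text \<open>A function on \<open>\<real> \<times> [0,T]\<close> is represented as \<open>v \<sigma> t\<close>; its values for \<open>t\<close>
  outside \<open>[0,T]\<close> play no role. Time derivatives are taken within \<open>[0,T]\<close>, hence are
  one-sided at the two end points.\<close>

definition space_deriv :: "nat \<Rightarrow> (real \<Rightarrow> real \<Rightarrow> real) \<Rightarrow> real \<Rightarrow> real \<Rightarrow> real" where
  "space_deriv j v \<sigma> t = (deriv ^^ j) (\<lambda>s. v s t) \<sigma>"

definition time_deriv :: "real \<Rightarrow> (real \<Rightarrow> real \<Rightarrow> real) \<Rightarrow> real \<Rightarrow> real \<Rightarrow> real" where
  "time_deriv T v \<sigma> t = vector_derivative (\<lambda>s. v \<sigma> s) (at t within {0..T})"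

text \<open>Regularity of a classical solution: every derivative occurring in the differential
  equation exists and is jointly continuous on \<open>\<real> \<times> [0,T]\<close>. This is the weakest regularity
  for which the equation has its classical pointwise meaning, so it is implied by any stronger
  notion of a smooth solution.\<close>

definition classically_smooth :: "real \<Rightarrow> (real \<Rightarrow> real \<Rightarrow> real) \<Rightarrow> bool" where
  "classically_smooth T v \<longleftrightarrow>
     (\<forall>j<4. \<forall>t\<in>{0..T}. \<forall>\<sigma>. (\<lambda>s. space_deriv j v s t) differentiable (at \<sigma>)) \<and>
     (\<forall>j\<le>4. continuous_on (UNIV \<times> {0..T}) (\<lambda>(\<sigma>, t). space_deriv j v \<sigma> t)) \<and>
     (\<forall>\<sigma>. \<forall>t\<in>{0..T}. (\<lambda>s. v \<sigma> s) differentiable (at t within {0..T})) \<and>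
     continuous_on (UNIV \<times> {0..T}) (\<lambda>(\<sigma>, t). time_deriv T v \<sigma> t)"

text \<open>By the differential equation, the last conjunct says that the derivative of \<open>R\<close> is
  positive, i.e. that \<open>R\<close> is expanding.\<close>

definition expanding_radius ::
    "real \<Rightarrow> real \<Rightarrow> real \<Rightarrow> real \<Rightarrow> (real \<Rightarrow> real) \<Rightarrow> bool" where
  "expanding_radius \<alpha> v\<^sub>c T R\<^sub>0 R \<longleftrightarrow>
     R 0 = R\<^sub>0 \<and>
     (\<forall>t\<in>{0..T}. R t > 0 \<and>
        (R has_real_derivative v\<^sub>c + (\<alpha> - 1) / R t) (at t within {0..T}) \<and>
        v\<^sub>c + (\<alpha> - 1) / R t > 0)"

definition solves_pde ::
    "real \<Rightarrow> real \<Rightarrow> real \<Rightarrow> real \<Rightarrow> (real \<Rightarrow> real) \<Rightarrow> (real \<Rightarrow> real \<Rightarrow> real) \<Rightarrow> bool" where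
  "solves_pde \<delta> \<alpha> v\<^sub>c T R v \<longleftrightarrow>
     (\<forall>\<sigma>. \<forall>t\<in>{0..T}.
        time_deriv T v \<sigma> t
        + \<delta> / R t ^ 4 * space_deriv 4 v \<sigma> t
        + 1 / (R t)\<^sup>2 * (\<alpha> - 1 + \<delta> / (R t)\<^sup>2) * space_deriv 2 v \<sigma> t
        + (\<alpha> - 1) / (R t)\<^sup>2 * v \<sigma> t
        - v\<^sub>c / (R t)\<^sup>2 * v \<sigma> t * space_deriv 1 v \<sigma> t = 0)"

definition periodic_grid :: "nat \<Rightarrow> (int \<Rightarrow> real) set" where
  "periodic_grid J = {V. \<forall>i. V (i + int J) = V i}"

definition space_step :: "nat \<Rightarrow> real" where
  "space_step J = 2 * pi / real J"

definition time_step :: "real \<Rightarrow> nat \<Rightarrow> real" where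
  "time_step T N = T / real N"

definition grid_restriction :: "nat \<Rightarrow> (real \<Rightarrow> real) \<Rightarrow> int \<Rightarrow> real" where
  "grid_restriction J f i = f (of_int i * space_step J)"

definition discrete_laplacian :: "real \<Rightarrow> (int \<Rightarrow> real) \<Rightarrow> int \<Rightarrow> real" where
  "discrete_laplacian h V i = (V (i - 1) - 2 * V i + V (i + 1)) / h\<^sup>2"

text \<open>The argument \<open>r\<close> is the radius \<open>R\<^sub>m\<close> at the time level in question.\<close>

definition discrete_operator ::
    "real \<Rightarrow> real \<Rightarrow> real \<Rightarrow> real \<Rightarrow> (int \<Rightarrow> real) \<Rightarrow> int \<Rightarrow> real" where
  "discrete_operator \<delta> \<alpha> h r V i =
     \<delta> / r ^ 4 * discrete_laplacian h (discrete_laplacian h V) i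
     + 1 / r\<^sup>2 * (\<alpha> - 1 + \<delta> / r\<^sup>2) * discrete_laplacian h V i
     + (\<alpha> - 1) / r\<^sup>2 * V i"

definition discrete_convection :: "(int \<Rightarrow> real) \<Rightarrow> (int \<Rightarrow> real) \<Rightarrow> int \<Rightarrow> real" where
  "discrete_convection V W i = (V (i - 1) + V i + V (i + 1)) * (W (i + 1) - W (i - 1))"

definition midpoint_level :: "(nat \<Rightarrow> int \<Rightarrow> real) \<Rightarrow> nat \<Rightarrow> int \<Rightarrow> real" where
  "midpoint_level V n i = (V n i + V (Suc n) i) / 2"

text \<open>Only the levels \<open>0, \<dots>, N\<close> of a sequence \<open>V\<close> are constrained.\<close>

definition crank_nicolson_solution ::
    "real \<Rightarrow> real \<Rightarrow> real \<Rightarrow> real \<Rightarrow> (real \<Rightarrow> real) \<Rightarrow> nat \<Rightarrow> nat \<Rightarrow>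
     (int \<Rightarrow> real) \<Rightarrow> (nat \<Rightarrow> int \<Rightarrow> real) \<Rightarrow> bool" where
  "crank_nicolson_solution \<delta> \<alpha> v\<^sub>c T R J N v\<^sub>0 V \<longleftrightarrow>
     (let h = space_step J; k = time_step T N in
        (\<forall>n\<le>N. V n \<in> periodic_grid J) \<and>
        V 0 = v\<^sub>0 \<and>
        (\<forall>n<N. let r = R ((real n + 1/2) * k); U = midpoint_level V n in
           \<forall>i. 1 / k * (V (Suc n) i - V n i) + discrete_operator \<delta> \<alpha> h r U i
               = v\<^sub>c / (6 * h * r\<^sup>2) * discrete_convection U U i))"

end

theory Submission
  imports Defs
begin

text \<open>Since \<open>h \<le> 2\<pi>\<close>, smallness of \<open>k h\<^sup>-\<^sup>1\<^sup>/\<^sup>5\<close> forces \<open>k\<close> to be small, and this alone gives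
  uniqueness. As \<open>(\<phi>(U,U),U) = 0\<close> and the linear part is coercive up to a multiple of \<open>\<parallel>U\<parallel>\<^sup>2\<close>, the
  discrete solutions are bounded in \<open>L\<^sup>2\<close> by their initial data. If two solutions agree at level \<open>n\<close>,
  test the equation for the midpoint difference \<open>Z\<close> with \<open>Z\<close> itself: the nonlinear contribution is
  a multiple of \<open>(\<phi>(Z,Z),W)/h\<close>, which by a discrete Sobolev inequality and the \<open>L\<^sup>2\<close> bound on \<open>W\<close> is
  at most \<open>\<eta> \<parallel>\<Delta>\<^sub>h Z\<parallel>\<^sup>2 + C \<parallel>Z\<parallel>\<^sup>2\<close>. The first term is absorbed by the fourth order part, the
  second by \<open>(2/k) \<parallel>Z\<parallel>\<^sup>2\<close>, so \<open>Z = 0\<close>.\<close>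

section \<open>Summation over one period of the grid\<close>

text \<open>The weight \<open>h\<close> of the discrete inner product is left out because the energy
  estimates are homogeneous in it. It is written explicitly wherever the size of the L2 norm
  matters.\<close>

definition grid_sum :: "nat \<Rightarrow> (int \<Rightarrow> real) \<Rightarrow> real" where
  "grid_sum J f = (\<Sum>m<J. f (int m))"

lemma grid_sum_add: "grid_sum J (\<lambda>i. f i + g i) = grid_sum J f + grid_sum J g"
  by (simp add: grid_sum_def sum.distrib)

lemma grid_sum_diff: "grid_sum J (\<lambda>i. f i - g i) = grid_sum J f - grid_sum J g"
  by (simp add: grid_sum_def sum_subtractf)

lemma grid_sum_cmult: "grid_sum J (\<lambda>i. c * f i) = c * grid_sum J f"
  by (simp add: grid_sum_def sum_distrib_left)

lemma grid_sum_mono: "(\<And>i. f i \<le> g i) \<Longrightarrow> grid_sum J f \<le> grid_sum J g"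
  by (simp add: grid_sum_def sum_mono)

lemma grid_sum_nonneg: "(\<And>i. 0 \<le> f i) \<Longrightarrow> 0 \<le> grid_sum J f"
  by (simp add: grid_sum_def sum_nonneg)

lemma periodic_grid_shift:
  "f \<in> periodic_grid J \<Longrightarrow> (\<lambda>i. f (i + c)) \<in> periodic_grid J"
  "f \<in> periodic_grid J \<Longrightarrow> (\<lambda>i. f (i - c)) \<in> periodic_grid J"
  unfolding periodic_grid_def
  by (auto simp: algebra_simps)
     (metis (no_types, opaque_lifting) add.commute add.left_commute add_diff_eq)+

lemma periodic_grid_map:
  "f \<in> periodic_grid J \<Longrightarrow> (\<lambda>i. F (f i)) \<in> periodic_grid J"
  by (auto simp: periodic_grid_def)

text \<open>Moving the window by one node trades its first entry for the one a period later, which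
  is equal. Integer induction in both directions then covers negative shifts as well.\<close>

lemma grid_sum_shift:
  assumes "f \<in> periodic_grid J"
  shows "grid_sum J (\<lambda>i. f (i + j)) = grid_sum J f"
proof -
  have step: "grid_sum J (\<lambda>i. f (i + (j + 1))) = grid_sum J (\<lambda>i. f (i + j))" for j
  proof -
    have "(\<Sum>m<J. f (int (Suc m) + j) - f (int m + j)) = f (int J + j) - f (int 0 + j)"
      by (rule sum_lessThan_telescope)
    also have "\<dots> = 0"
      using assms by (simp add: periodic_grid_def add.commute)
    finally show ?thesis
      by (simp add: grid_sum_def sum_subtractf algebra_simps)
  qed
  show ?thesis
  proof (induction j rule: int_induct[where k = 0])
    case (step2 i)
    then show ?case using step[of "i - 1"] by simp
  qed (simp_all add: step)
qed

text \<open>This is the common form of every summation by parts below: it suffices to exhibit a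
  periodic flux \<open>H\<close> and to check a pointwise identity.\<close>

lemma grid_sum_telescope:
  assumes "H \<in> periodic_grid J" and "\<And>i. f i = H i - H (i - 1)"
  shows "grid_sum J f = 0"
proof -
  have "f = (\<lambda>i. H i - H (i - 1))" using assms(2) by blast
  then show ?thesis
    using grid_sum_shift[OF assms(1), of "-1"] by (simp add: grid_sum_diff)
qed

lemma member_le_grid_sum:
  assumes "f \<in> periodic_grid J" and "\<And>i. 0 \<le> f i" and "J > 0"
  shows "f i \<le> grid_sum J f"
proof -
  have "f (int 0 + i) \<le> (\<Sum>m<J. f (int m + i))"
    by (rule member_le_sum) (use assms in auto)
  then show ?thesis
    using grid_sum_shift[OF assms(1), of i] by (simp add: grid_sum_def)
qed

section \<open>Summation by parts and interpolation for the discrete Laplacian\<close>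

lemma periodic_grid_discrete_laplacian:
  assumes "V \<in> periodic_grid J"
  shows "discrete_laplacian h V \<in> periodic_grid J"
  using periodic_grid_shift(1)[OF assms, of 1] periodic_grid_shift(2)[OF assms, of 1] assms
  by (simp add: periodic_grid_def discrete_laplacian_def)

lemma discrete_laplacian_symmetric:
  assumes "f \<in> periodic_grid J" and "g \<in> periodic_grid J"
  shows "grid_sum J (\<lambda>i. discrete_laplacian h f i * g i)
    = grid_sum J (\<lambda>i. f i * discrete_laplacian h g i)"
proof -
  have "grid_sum J (\<lambda>i. discrete_laplacian h f i * g i - f i * discrete_laplacian h g i) = 0"
  proof (rule grid_sum_telescope)
    \<comment> \<open>The flux is the discrete Wronskian of \<open>f\<close> and
      \<open>g\<close>.\<close>
    show "(\<lambda>i. (f (i + 1) * g i - f i * g (i + 1)) / h\<^sup>2) \<in> periodic_grid J"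
      using periodic_grid_shift(1)[OF assms(1), of 1] periodic_grid_shift(1)[OF assms(2), of 1] assms
      by (simp add: periodic_grid_def)
    fix i
    show "discrete_laplacian h f i * g i - f i * discrete_laplacian h g i
      = (f (i + 1) * g i - f i * g (i + 1)) / h\<^sup>2
        - (f (i - 1 + 1) * g (i - 1) - f (i - 1) * g (i - 1 + 1)) / h\<^sup>2"
      by (simp add: discrete_laplacian_def diff_divide_distrib add_divide_distrib algebra_simps)
  qed
  then show ?thesis by (simp add: grid_sum_diff)
qed

lemma grid_sum_forward_difference_sq:
  assumes "f \<in> periodic_grid J"
  shows "grid_sum J (\<lambda>i. ((f (i + 1) - f i) / h)\<^sup>2)
    = - grid_sum J (\<lambda>i. discrete_laplacian h f i * f i)"
proof -
  have "grid_sum J (\<lambda>i. ((f (i + 1) - f i) / h)\<^sup>2 + discrete_laplacian h f i * f i) = 0"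
  proof (rule grid_sum_telescope)
    show "(\<lambda>i. ((f (i + 1))\<^sup>2 - f (i + 1) * f i) / h\<^sup>2) \<in> periodic_grid J"
      using periodic_grid_shift(1)[OF assms(1), of 1] assms by (simp add: periodic_grid_def)
    fix i
    show "((f (i + 1) - f i) / h)\<^sup>2 + discrete_laplacian h f i * f i
      = ((f (i + 1))\<^sup>2 - f (i + 1) * f i) / h\<^sup>2
        - ((f (i - 1 + 1))\<^sup>2 - f (i - 1 + 1) * f (i - 1)) / h\<^sup>2"
      by (simp add: discrete_laplacian_def power_divide diff_divide_distrib add_divide_distrib
          algebra_simps power2_eq_square)
  qed
  then show ?thesis by (simp add: grid_sum_add)
qed

text \<open>Completing the square. The weight \<open>c\<close> is free, so the \<open>x\<close> part
  can be made small enough to be absorbed elsewhere.\<close>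

lemma weighted_young:
  fixes x y c :: real
  assumes "c > 0"
  shows "\<bar>b * x * y\<bar> \<le> c * x\<^sup>2 + b\<^sup>2 / (4 * c) * y\<^sup>2"
proof -
  have "0 \<le> (2 * c * \<bar>x\<bar> - \<bar>b\<bar> * \<bar>y\<bar>)\<^sup>2" by simp
  also have "\<dots> = 4 * c * (c * x\<^sup>2 + b\<^sup>2 / (4 * c) * y\<^sup>2 - \<bar>b * x * y\<bar>)"
    using assms by (simp add: power2_eq_square field_simps abs_mult)
  finally show ?thesis
    using assms by (simp add: zero_le_mult_iff)
qed

text \<open>Summation by parts followed by Young's inequality: first differences are interpolated
  between second differences, with an arbitrarily small factor, and the function itself.\<close>

lemma grid_sum_forward_difference_sq_le:
  assumes "f \<in> periodic_grid J" and "\<eta> > 0"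
  shows "grid_sum J (\<lambda>i. ((f (i + 1) - f i) / h)\<^sup>2)
    \<le> \<eta> * grid_sum J (\<lambda>i. (discrete_laplacian h f i)\<^sup>2) + 1 / (4 * \<eta>) * grid_sum J (\<lambda>i. (f i)\<^sup>2)"
proof -
  have "grid_sum J (\<lambda>i. (- 1) * (discrete_laplacian h f i * f i))
    \<le> grid_sum J (\<lambda>i. \<eta> * (discrete_laplacian h f i)\<^sup>2 + 1 / (4 * \<eta>) * (f i)\<^sup>2)"
    using weighted_young[OF assms(2), of "-1"] by (intro grid_sum_mono) (smt (verit) power_one
        power2_minus mult_minus_left mult_1)
  then show ?thesis
    unfolding grid_sum_add grid_sum_cmult grid_sum_forward_difference_sq[OF assms(1)] by simp
qed

section \<open>Coercivity of the linear operator\<close>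

text \<open>The fourth order term is positive, and half of it controls the second order term, whose
  coefficient may have either sign. The constants depend on the range of the radius but not on the
  grid.\<close>

lemma discrete_operator_coercive:
  assumes "\<delta> > 0" and "\<rho> > 0" and "\<rho> \<le> P"
  shows "\<exists>c>0. \<exists>C\<ge>0. \<forall>r\<in>{\<rho>..P}. \<forall>h J V. V \<in> periodic_grid J \<longrightarrow>
    c * grid_sum J (\<lambda>i. (discrete_laplacian h V i)\<^sup>2) - C * grid_sum J (\<lambda>i. (V i)\<^sup>2)
      \<le> grid_sum J (\<lambda>i. discrete_operator \<delta> \<alpha> h r V i * V i)"
proof -
  \<comment> \<open>Half of the smallest leading coefficient, attained at \<open>r = P\<close>; the
    other half is spent in Young's inequality. \<open>B\<close> bounds the second order coefficient
    on the whole range of \<open>r\<close>.\<close>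
  define c where "c = \<delta> / P ^ 4 / 2"
  define B where "B = 1 / \<rho>\<^sup>2 * (\<bar>\<alpha> - 1\<bar> + \<delta> / \<rho>\<^sup>2)"
  define C where "C = B\<^sup>2 / (4 * c) + \<bar>\<alpha> - 1\<bar> / \<rho>\<^sup>2"
  have c: "c > 0" using assms by (simp add: c_def)
  have C: "C \<ge> 0" using c by (simp add: C_def)
  have "c * grid_sum J (\<lambda>i. (discrete_laplacian h V i)\<^sup>2) - C * grid_sum J (\<lambda>i. (V i)\<^sup>2)
      \<le> grid_sum J (\<lambda>i. discrete_operator \<delta> \<alpha> h r V i * V i)"
    if r: "r \<in> {\<rho>..P}" and V: "V \<in> periodic_grid J" for r h J V
  proof -
    let ?D = "discrete_laplacian h"
    define b where "b = 1 / r\<^sup>2 * (\<alpha> - 1 + \<delta> / r\<^sup>2)"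
    have r0: "0 < r" using r assms by simp
    have a: "2 * c \<le> \<delta> / r ^ 4"
      using r r0 assms unfolding c_def by (auto intro!: divide_left_mono power_mono)
    have rr: "1 / r\<^sup>2 \<le> 1 / \<rho>\<^sup>2"
      using r assms by (auto intro!: divide_left_mono power_mono)
    have dr: "\<delta> / r\<^sup>2 \<le> \<delta> / \<rho>\<^sup>2"
      using r assms by (auto intro!: divide_left_mono power_mono)
    have "\<bar>b\<bar> = 1 / r\<^sup>2 * \<bar>\<alpha> - 1 + \<delta> / r\<^sup>2\<bar>" by (simp add: b_def abs_mult)
    also have "\<dots> \<le> B"
      unfolding B_def
    proof (rule mult_mono[OF rr])
      have "0 \<le> \<delta> / r\<^sup>2" using assms by simp
      then show "\<bar>\<alpha> - 1 + \<delta> / r\<^sup>2\<bar> \<le> \<bar>\<alpha> - 1\<bar> + \<delta> / \<rho>\<^sup>2" using dr by linarith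
    qed auto
    finally have b: "b\<^sup>2 \<le> B\<^sup>2" by (metis abs_le_square_iff abs_ge_self order_trans)
    have q: "\<bar>(\<alpha> - 1) / r\<^sup>2\<bar> \<le> \<bar>\<alpha> - 1\<bar> / \<rho>\<^sup>2"
      using mult_left_mono[OF rr, of "\<bar>\<alpha> - 1\<bar>"] by simp
    have pt: "c * (?D V i)\<^sup>2 - C * (V i)\<^sup>2
      \<le> \<delta> / r ^ 4 * (?D V i)\<^sup>2 + (b * ?D V i * V i + (\<alpha> - 1) / r\<^sup>2 * (V i)\<^sup>2)" for i
    proof -
      have "- (b * ?D V i * V i) \<le> c * (?D V i)\<^sup>2 + b\<^sup>2 / (4 * c) * (V i)\<^sup>2"
        using weighted_young[OF c, of b "?D V i" "V i"] by linarith
      moreover have "b\<^sup>2 / (4 * c) * (V i)\<^sup>2 \<le> B\<^sup>2 / (4 * c) * (V i)\<^sup>2"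
        using b c by (intro mult_right_mono divide_right_mono) auto
      moreover have "- ((\<alpha> - 1) / r\<^sup>2 * (V i)\<^sup>2) \<le> \<bar>\<alpha> - 1\<bar> / \<rho>\<^sup>2 * (V i)\<^sup>2"
        unfolding minus_mult_left
        by (intro mult_right_mono order_trans[OF abs_ge_minus_self q] zero_le_power2)
      moreover have "2 * c * (?D V i)\<^sup>2 \<le> \<delta> / r ^ 4 * (?D V i)\<^sup>2"
        using a by (intro mult_right_mono) auto
      ultimately show ?thesis unfolding C_def distrib_right by linarith
    qed
    have "grid_sum J (\<lambda>i. discrete_operator \<delta> \<alpha> h r V i * V i)
      = grid_sum J (\<lambda>i. \<delta> / r ^ 4 * (?D (?D V) i * V i)
          + (b * ?D V i * V i + (\<alpha> - 1) / r\<^sup>2 * (V i)\<^sup>2))"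
      by (simp only: discrete_operator_def b_def distrib_right power2_eq_square mult.assoc add.assoc)
    also have "\<dots> = grid_sum J (\<lambda>i. \<delta> / r ^ 4 * (?D V i)\<^sup>2
          + (b * ?D V i * V i + (\<alpha> - 1) / r\<^sup>2 * (V i)\<^sup>2))"
      using discrete_laplacian_symmetric[OF periodic_grid_discrete_laplacian[OF V] V, of h h]
      by (simp only: grid_sum_add grid_sum_cmult power2_eq_square)
    also have "\<dots> \<ge> grid_sum J (\<lambda>i. c * (?D V i)\<^sup>2 - C * (V i)\<^sup>2)"
      by (rule grid_sum_mono) (rule pt)
    finally show ?thesis by (simp only: grid_sum_diff grid_sum_cmult)
  qed
  with c C show ?thesis by blast
qed

section \<open>Cancellation in the convection form\<close>

text \<open>Multiplying \<open>(x + y + z) * (z - x)\<close> by the middle value \<open>y\<close>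
  gives \<open>y * z * (y + z) - x * y * (x + y)\<close>, a difference of neighbouring fluxes. This
  is the discrete counterpart of the vanishing integral of \<open>v^2\<close> times the space
  derivative of \<open>v\<close>.\<close>

lemma discrete_convection_energy:
  assumes "V \<in> periodic_grid J"
  shows "grid_sum J (\<lambda>i. discrete_convection V V i * V i) = 0"
proof (rule grid_sum_telescope)
  show "(\<lambda>i. V i * V (i + 1) * (V i + V (i + 1))) \<in> periodic_grid J"
    using periodic_grid_shift(1)[OF assms, of 1] assms by (simp add: periodic_grid_def)
  fix i
  show "discrete_convection V V i * V i = V i * V (i + 1) * (V i + V (i + 1))
    - V (i - 1) * V (i - 1 + 1) * (V (i - 1) + V (i - 1 + 1))"
    by (simp add: discrete_convection_def algebra_simps)
qed

text \<open>The cubic form \<open>(\<phi>(V,V),V)\<close> vanishes identically; polarising this moves all terms onto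
  \<open>(\<phi>(Z,Z),W)\<close>, in which \<open>W\<close> is not differenced.\<close>

lemma discrete_convection_diff_energy:
  assumes "Z \<in> periodic_grid J" and "W \<in> periodic_grid J"
  shows "grid_sum J (\<lambda>i. (discrete_convection (\<lambda>i. W i + Z i) (\<lambda>i. W i + Z i) i
      - discrete_convection W W i) * Z i)
    = - grid_sum J (\<lambda>i. discrete_convection Z Z i * W i)"
proof -
  \<comment> \<open>Obtained by putting \<open>W + Z\<close> into the flux of the cubic form and
    keeping the parts of degree three in \<open>Z\<close> and of degree two in \<open>Z\<close> and
    one in \<open>W\<close>. The summand below consists of the same two parts of the form.\<close>
  let ?H = "\<lambda>i. Z i * Z (i + 1) * (Z i + Z (i + 1))
    + (W i * Z (i + 1) + Z i * W (i + 1)) * (Z i + Z (i + 1)) + Z i * Z (i + 1) * (W i + W (i + 1))"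
  have "grid_sum J (\<lambda>i. (discrete_convection (\<lambda>i. W i + Z i) (\<lambda>i. W i + Z i) i
      - discrete_convection W W i) * Z i + discrete_convection Z Z i * W i) = 0"
  proof (rule grid_sum_telescope)
    show "?H \<in> periodic_grid J"
      using periodic_grid_shift(1)[OF assms(1), of 1] periodic_grid_shift(1)[OF assms(2), of 1] assms
      by (simp add: periodic_grid_def)
  qed (simp add: discrete_convection_def algebra_simps)
  then show ?thesis by (simp add: grid_sum_add)
qed

section \<open>Discrete Sobolev inequality and the bound for the convection form\<close>

text \<open>A value exceeds any other value by at most the total variation over a period; summing
  over all the other nodes replaces them by their mean.\<close>

lemma periodic_grid_oscillation:
  assumes "f \<in> periodic_grid J"
  shows "real J * f i \<le> grid_sum J f + real J * grid_sum J (\<lambda>i. \<bar>f (i + 1) - f i\<bar>)"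
proof -
  let ?P = "grid_sum J (\<lambda>i. \<bar>f (i + 1) - f i\<bar>)"
  have per: "(\<lambda>i. \<bar>f (i + 1) - f i\<bar>) \<in> periodic_grid J"
    using periodic_grid_shift(1)[OF assms, of 1] assms by (simp add: periodic_grid_def)
  have "f i \<le> f (int m + i) + ?P" if "m < J" for m
  proof -
    have "f i - f (int m + i) = (\<Sum>l<m. f (int l + i) - f (int (Suc l) + i))"
      using sum_lessThan_telescope'[of "\<lambda>l. f (int l + i)" m] by simp
    also have "\<dots> \<le> (\<Sum>l<m. \<bar>f (int l + i + 1) - f (int l + i)\<bar>)"
      by (rule sum_mono) (simp add: algebra_simps)
    also have "\<dots> \<le> (\<Sum>l<J. \<bar>f (int l + i + 1) - f (int l + i)\<bar>)"
      using that by (intro sum_mono2) auto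
    also have "\<dots> = ?P"
      using grid_sum_shift[OF per, of i] by (simp add: grid_sum_def)
    finally show ?thesis by simp
  qed
  then have "(\<Sum>m<J. f i) \<le> (\<Sum>m<J. f (int m + i) + ?P)"
    by (intro sum_mono) auto
  also have "\<dots> = grid_sum J f + real J * ?P"
    using grid_sum_shift[OF assms, of i] by (simp add: grid_sum_def sum.distrib)
  finally show ?thesis by simp
qed

text \<open>The oscillation bound is applied to the square of \<open>Z\<close>, whose variation is a
  product of a difference quotient and a sum of neighbours. The constants are independent of
  \<open>J\<close>.\<close>

lemma discrete_sobolev:
  assumes "Z \<in> periodic_grid J" and "J > 0" and h: "h = space_step J"
  shows "(Z i)\<^sup>2 \<le> h * (3 * grid_sum J (\<lambda>i. (Z i)\<^sup>2)
    + 1 / 2 * grid_sum J (\<lambda>i. ((Z (i + 1) - Z i) / h)\<^sup>2))"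
proof -
  let ?a = "grid_sum J (\<lambda>i. (Z i)\<^sup>2)" and ?b = "grid_sum J (\<lambda>i. ((Z (i + 1) - Z i) / h)\<^sup>2)"
  have hpos: "h > 0" using assms by (simp add: space_step_def)
  have sq: "(\<lambda>i. (Z i)\<^sup>2) \<in> periodic_grid J" by (rule periodic_grid_map[OF assms(1)])
  have "\<bar>(Z (i + 1))\<^sup>2 - (Z i)\<^sup>2\<bar>
    \<le> h / 2 * ((Z (i + 1) - Z i) / h)\<^sup>2 + (h * (Z (i + 1))\<^sup>2 + h * (Z i)\<^sup>2)" for i
  proof -
    have "(Z (i + 1))\<^sup>2 - (Z i)\<^sup>2 = h * ((Z (i + 1) - Z i) / h) * (Z (i + 1) + Z i)"
      using hpos by (simp add: power2_eq_square field_simps)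
    \<comment> \<open>The weight \<open>h / 2\<close> leaves a factor \<open>h\<close> in front of
      both squares.\<close>
    also have "\<bar>\<dots>\<bar> \<le> h / 2 * ((Z (i + 1) - Z i) / h)\<^sup>2 + h\<^sup>2 / (4 * (h / 2)) * (Z (i + 1) + Z i)\<^sup>2"
      by (rule weighted_young) (use hpos in auto)
    also have "h\<^sup>2 / (4 * (h / 2)) = h / 2" using hpos by (simp add: power2_eq_square)
    also have "h / 2 * (Z (i + 1) + Z i)\<^sup>2 \<le> h / 2 * (2 * (Z (i + 1))\<^sup>2 + 2 * (Z i)\<^sup>2)"
      using hpos sum_squares_bound[of "Z (i + 1)" "Z i"]
      by (intro mult_left_mono) (auto simp: power2_sum)
    finally show ?thesis by (simp add: algebra_simps)
  qed
  then have "grid_sum J (\<lambda>i. \<bar>(Z (i + 1))\<^sup>2 - (Z i)\<^sup>2\<bar>)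
    \<le> grid_sum J (\<lambda>i. h / 2 * ((Z (i + 1) - Z i) / h)\<^sup>2 + (h * (Z (i + 1))\<^sup>2 + h * (Z i)\<^sup>2))"
    by (intro grid_sum_mono) auto
  also have "\<dots> = h / 2 * ?b + (h * ?a + h * ?a)"
    unfolding grid_sum_add grid_sum_cmult using grid_sum_shift[OF sq, of 1] by simp
  finally have osc: "grid_sum J (\<lambda>i. \<bar>(Z (i + 1))\<^sup>2 - (Z i)\<^sup>2\<bar>) \<le> h * (2 * ?a + 1 / 2 * ?b)"
    by (simp add: algebra_simps)
  have a0: "0 \<le> ?a" by (rule grid_sum_nonneg) simp
  have "real J * (Z i)\<^sup>2 \<le> ?a + real J * (h * (2 * ?a + 1 / 2 * ?b))"
    using periodic_grid_oscillation[OF sq, of i] mult_left_mono[OF osc, of "real J"] by simp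
  then have "(Z i)\<^sup>2 \<le> (?a + real J * (h * (2 * ?a + 1 / 2 * ?b))) / real J"
    using assms(2) by (simp add: field_simps)
  also have "\<dots> = ?a / real J + h * (2 * ?a + 1 / 2 * ?b)"
    using assms(2) by (simp add: add_divide_distrib)
  \<comment> \<open>The mean has weight \<open>1 / J\<close>, which is at most
    \<open>h = 2 * pi / J\<close>; this raises the coefficient of \<open>?a\<close> from 2 to
    3.\<close>
  also have "?a / real J \<le> h * ?a"
    using a0 pi_gt3 assms(2) mult_right_mono[of 1 "2 * pi" ?a] unfolding h space_step_def
    by (simp add: divide_right_mono)
  finally show ?thesis by (simp add: algebra_simps)
qed

text \<open>Differences of \<open>Z\<close> are paired with the product of a maximum of
  \<open>Z\<close> and \<open>W\<close>, so that only the L2 norm of \<open>W\<close> enters. The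
  Sobolev inequality controls the maximum, and interpolation then trades first differences for
  second ones.\<close>

lemma discrete_convection_bound:
  assumes "K \<ge> 0" and "\<eta> > 0"
  shows "\<exists>C\<ge>0. \<forall>J h Z W. J > 0 \<longrightarrow> h = space_step J \<longrightarrow> Z \<in> periodic_grid J \<longrightarrow> W \<in> periodic_grid J \<longrightarrow>
    h * grid_sum J (\<lambda>i. (W i)\<^sup>2) \<le> K \<longrightarrow>
    \<bar>grid_sum J (\<lambda>i. discrete_convection Z Z i * W i)\<bar> / h
      \<le> \<eta> * grid_sum J (\<lambda>i. (discrete_laplacian h Z i)\<^sup>2) + C * grid_sum J (\<lambda>i. (Z i)\<^sup>2)"
proof -
  \<comment> \<open>\<open>L\<close> is the total coefficient of \<open>?b\<close>: 2 from the two
    difference quotients and \<open>9 / 2 * K * (1 / 2)\<close> from \<open>S\<close>. Interpolating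
    with \<open>\<eta> / L\<close> makes the final coefficient equal to
    \<open>\<eta>\<close>.\<close>
  define L where "L = 2 + 9 / 4 * K"
  define C where "C = L * (1 / (4 * (\<eta> / L))) + 27 / 2 * K"
  have L: "L > 0" using assms by (simp add: L_def)
  have C: "C \<ge> 0" using assms L by (simp add: C_def)
  have "\<bar>grid_sum J (\<lambda>i. discrete_convection Z Z i * W i)\<bar> / h
      \<le> \<eta> * grid_sum J (\<lambda>i. (discrete_laplacian h Z i)\<^sup>2) + C * grid_sum J (\<lambda>i. (Z i)\<^sup>2)"
    if J: "J > 0" and h: "h = space_step J" and Z: "Z \<in> periodic_grid J"
      and W: "W \<in> periodic_grid J" and K: "h * grid_sum J (\<lambda>i. (W i)\<^sup>2) \<le> K" for J h Z W
  proof -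
    let ?D = "\<lambda>i. (Z (i + 1) - Z i) / h"
    let ?a = "grid_sum J (\<lambda>i. (Z i)\<^sup>2)" and ?b = "grid_sum J (\<lambda>i. (?D i)\<^sup>2)"
    define S where "S = 3 * ?a + 1 / 2 * ?b"
    have hpos: "h > 0" using J h by (simp add: space_step_def)
    have S0: "0 \<le> S" unfolding S_def
      using grid_sum_nonneg[of "\<lambda>i. (Z i)\<^sup>2" J] grid_sum_nonneg[of "\<lambda>i. (?D i)\<^sup>2" J] by simp
    have sup: "(Z i)\<^sup>2 \<le> h * S" for i
      unfolding S_def by (rule discrete_sobolev[OF Z J h])
    have Dper: "(\<lambda>i. (?D i)\<^sup>2) \<in> periodic_grid J"
      using periodic_grid_shift(1)[OF Z, of 1] Z by (simp add: periodic_grid_def)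
    have sq2: "(x + y)\<^sup>2 \<le> 2 * x\<^sup>2 + 2 * y\<^sup>2" for x y :: real
      using sum_squares_bound[of x y] by (simp add: power2_sum)
    \<comment> \<open>The central difference is \<open>h\<close> times the sum of two neighbouring
      forward quotients, which cancels the division by \<open>h\<close>. The form
      \<open>i + (- 1)\<close> is the one that \<open>grid_sum_shift\<close> matches.\<close>
    have pt: "\<bar>discrete_convection Z Z i * W i\<bar> / h
      \<le> (?D i)\<^sup>2 + (?D (i + (- 1)))\<^sup>2 + 9 / 2 * (h * S) * (W i)\<^sup>2" for i
    proof -
      have s: "(Z (i - 1) + Z i + Z (i + 1))\<^sup>2 \<le> 9 * (h * S)"
      proof -
        have "(Z (i - 1) + Z i + Z (i + 1))\<^sup>2 \<le> 3 * ((Z (i - 1))\<^sup>2 + (Z i)\<^sup>2 + (Z (i + 1))\<^sup>2)"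
          using sum_squares_bound[of "Z (i - 1)" "Z i"] sum_squares_bound[of "Z (i - 1)" "Z (i + 1)"]
            sum_squares_bound[of "Z i" "Z (i + 1)"] by (simp add: power2_eq_square algebra_simps)
        also have "\<dots> \<le> 3 * (h * S + h * S + h * S)"
          by (intro mult_left_mono add_mono sup) simp
        finally show ?thesis by (simp add: mult_ac)
      qed
      have "\<bar>discrete_convection Z Z i * W i\<bar> / h
        = \<bar>1 * (?D i + ?D (i + (- 1))) * ((Z (i - 1) + Z i + Z (i + 1)) * W i)\<bar>"
        using hpos by (simp add: discrete_convection_def add_divide_distrib[symmetric] abs_mult)
      also have "\<dots> \<le> 1 / 2 * (?D i + ?D (i + (- 1)))\<^sup>2
          + 1\<^sup>2 / (4 * (1 / 2)) * ((Z (i - 1) + Z i + Z (i + 1)) * W i)\<^sup>2"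
        by (rule weighted_young) simp
      also have "((Z (i - 1) + Z i + Z (i + 1)) * W i)\<^sup>2 \<le> 9 * (h * S) * (W i)\<^sup>2"
        unfolding power_mult_distrib using s by (intro mult_right_mono) auto
      finally show ?thesis using sq2[of "?D i" "?D (i + (- 1))"] by simp
    qed
    have "\<bar>grid_sum J (\<lambda>i. discrete_convection Z Z i * W i)\<bar>
      \<le> grid_sum J (\<lambda>i. \<bar>discrete_convection Z Z i * W i\<bar>)"
      by (simp add: grid_sum_def sum_abs)
    then have "\<bar>grid_sum J (\<lambda>i. discrete_convection Z Z i * W i)\<bar> / h
      \<le> grid_sum J (\<lambda>i. \<bar>discrete_convection Z Z i * W i\<bar>) / h"
      using hpos by (simp add: divide_right_mono)
    also have "\<dots> = grid_sum J (\<lambda>i. \<bar>discrete_convection Z Z i * W i\<bar> / h)"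
      by (simp add: grid_sum_def sum_divide_distrib)
    also have "\<dots> \<le> grid_sum J (\<lambda>i. (?D i)\<^sup>2 + (?D (i + (- 1)))\<^sup>2 + 9 / 2 * (h * S) * (W i)\<^sup>2)"
      by (rule grid_sum_mono) (rule pt)
    also have "\<dots> = 2 * ?b + 9 / 2 * (h * S) * grid_sum J (\<lambda>i. (W i)\<^sup>2)"
      unfolding grid_sum_add grid_sum_cmult using grid_sum_shift[OF Dper, of "- 1"] by simp
    \<comment> \<open>The factor \<open>h\<close> from the Sobolev inequality is the weight needed
      for the L2 bound on \<open>W\<close>.\<close>
    also have "\<dots> \<le> 2 * ?b + 9 / 2 * S * K"
      using mult_left_mono[OF K S0] by (simp add: mult_ac)
    also have "\<dots> = L * ?b + 27 / 2 * K * ?a"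
      by (simp add: S_def L_def algebra_simps)
    also have "\<dots> \<le> L * (\<eta> / L * grid_sum J (\<lambda>i. (discrete_laplacian h Z i)\<^sup>2)
        + 1 / (4 * (\<eta> / L)) * ?a) + 27 / 2 * K * ?a"
      using L assms by (intro add_right_mono mult_left_mono grid_sum_forward_difference_sq_le[OF Z]) auto
    also have "\<dots> = \<eta> * grid_sum J (\<lambda>i. (discrete_laplacian h Z i)\<^sup>2) + C * ?a"
      using L by (simp add: C_def algebra_simps)
    finally show ?thesis .
  qed
  with C show ?thesis by blast
qed

section \<open>Energy identity and L2 bound for the scheme\<close>

lemma crank_nicolson_step:
  assumes "crank_nicolson_solution \<delta> \<alpha> v\<^sub>c T R J N v\<^sub>0 V" and "n < N"
    and "h = space_step J" and "k = time_step T N" and "r = R ((real n + 1/2) * k)"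
  shows "1 / k * (V (Suc n) i - V n i) + discrete_operator \<delta> \<alpha> h r (midpoint_level V n) i
    = v\<^sub>c / (6 * h * r\<^sup>2) * discrete_convection (midpoint_level V n) (midpoint_level V n) i"
  using assms by (simp add: crank_nicolson_solution_def Let_def)

lemma crank_nicolson_periodic:
  assumes "crank_nicolson_solution \<delta> \<alpha> v\<^sub>c T R J N v\<^sub>0 V"
  shows "n \<le> N \<Longrightarrow> V n \<in> periodic_grid J"
    and "n < N \<Longrightarrow> midpoint_level V n \<in> periodic_grid J"
  using assms by (auto simp: crank_nicolson_solution_def Let_def midpoint_level_def periodic_grid_def)

lemma midpoint_time_in:
  assumes "n < N" and "T > 0"
  shows "(real n + 1/2) * time_step T N \<in> {0..T}"
proof -
  have "(real n + 1/2) / real N \<le> 1" using assms by simp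
  then have "T * ((real n + 1/2) / real N) \<le> T * 1" using assms by (intro mult_left_mono) auto
  then show ?thesis using assms by (simp add: time_step_def mult.commute)
qed

text \<open>Testing with the midpoint turns the time difference into a difference of squares, and
  the convection term drops out by \<open>discrete_convection_energy\<close>.\<close>

lemma crank_nicolson_energy:
  assumes sol: "crank_nicolson_solution \<delta> \<alpha> v\<^sub>c T R J N v\<^sub>0 V" and "n < N" and "T > 0"
    and h: "h = space_step J" and k: "k = time_step T N" and r: "r = R ((real n + 1/2) * k)"
  shows "grid_sum J (\<lambda>i. (V (Suc n) i)\<^sup>2) - grid_sum J (\<lambda>i. (V n i)\<^sup>2)
    = - 2 * k * grid_sum J (\<lambda>i. discrete_operator \<delta> \<alpha> h r (midpoint_level V n) i * midpoint_level V n i)"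
proof -
  let ?U = "midpoint_level V n"
  have kpos: "k > 0" using assms by (simp add: time_step_def)
  have pt: "(V (Suc n) i)\<^sup>2 - (V n i)\<^sup>2 = - 2 * k * (discrete_operator \<delta> \<alpha> h r ?U i * ?U i)
    + 2 * k * (v\<^sub>c / (6 * h * r\<^sup>2)) * (discrete_convection ?U ?U i * ?U i)" for i
  proof -
    have "(V (Suc n) i)\<^sup>2 - (V n i)\<^sup>2 = 2 * k * (1 / k * (V (Suc n) i - V n i)) * ?U i"
      using kpos by (simp add: midpoint_level_def power2_eq_square algebra_simps)
    also have "1 / k * (V (Suc n) i - V n i) = v\<^sub>c / (6 * h * r\<^sup>2) * discrete_convection ?U ?U i
        - discrete_operator \<delta> \<alpha> h r ?U i"
      using crank_nicolson_step[OF sol assms(2) h k r, of i] by linarith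
    finally show ?thesis by (simp add: algebra_simps)
  qed
  show ?thesis
    unfolding grid_sum_diff[symmetric] pt grid_sum_add grid_sum_cmult
    by (simp add: discrete_convection_energy[OF crank_nicolson_periodic(2)[OF sol assms(2)]])
qed

text \<open>Solving for the new value costs a factor \<open>(1 + y) / (1 - y)\<close>, which is at
  most \<open>1 + 4 * y\<close> for \<open>y\<close> in the assumed range.\<close>

lemma discrete_gronwall_implicit:
  fixes x :: "nat \<Rightarrow> real"
  assumes "\<And>n. n < N \<Longrightarrow> x (Suc n) - x n \<le> y * (x n + x (Suc n))"
    and "0 \<le> y" and "y \<le> 1 / 2" and "0 \<le> x 0" and "n \<le> N"
  shows "x n \<le> exp (4 * y * real n) * x 0"
  using assms(5)
proof (induction n)
  case (Suc n)
  let ?E = "exp (4 * y * real n) * x 0"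
  have "(1 - y) * x (Suc n) \<le> (1 + y) * x n"
    using assms(1)[of n] Suc.prems by (simp add: algebra_simps)
  also have "\<dots> \<le> (1 + y) * ?E"
    using Suc assms(2) by (intro mult_left_mono) auto
  \<comment> \<open>The two factors differ by \<open>2 * y * (1 - 2 * y)\<close>, which is
    nonnegative because \<open>y \<le> 1 / 2\<close>.\<close>
  also have "\<dots> \<le> ((1 - y) * (1 + 4 * y)) * ?E"
  proof (intro mult_right_mono)
    have "y * y \<le> y * (1 / 2)" using assms by (intro mult_left_mono) auto
    then show "1 + y \<le> (1 - y) * (1 + 4 * y)" by (simp add: algebra_simps)
  qed (use assms in auto)
  finally have "(1 - y) * x (Suc n) \<le> (1 - y) * ((1 + 4 * y) * ?E)" by (simp only: mult.assoc)
  then have "x (Suc n) \<le> (1 + 4 * y) * ?E" using assms(3) by simp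
  also have "\<dots> \<le> exp (4 * y) * ?E"
    using assms exp_ge_add_one_self[of "4 * y"] by (intro mult_right_mono) auto
  also have "\<dots> = exp (4 * y * real (Suc n)) * x 0"
    by (simp add: exp_add[symmetric] algebra_simps)
  finally show ?case .
qed simp

lemma discrete_operator_diff:
  "discrete_operator \<delta> \<alpha> h r (\<lambda>i. V i - W i) i
    = discrete_operator \<delta> \<alpha> h r V i - discrete_operator \<delta> \<alpha> h r W i"
proof -
  have lap: "discrete_laplacian h (\<lambda>i. V i - W i)
    = (\<lambda>i. discrete_laplacian h V i - discrete_laplacian h W i)" for V W
    by (rule ext) (simp add: discrete_laplacian_def diff_divide_distrib add_divide_distrib)
  show ?thesis
    unfolding discrete_operator_def lap by (simp add: right_diff_distrib)
qed

lemma grid_sum_midpoint_sq_le: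
  "grid_sum J (\<lambda>i. (midpoint_level V n i)\<^sup>2)
    \<le> (grid_sum J (\<lambda>i. (V n i)\<^sup>2) + grid_sum J (\<lambda>i. (V (Suc n) i)\<^sup>2)) / 2"
proof -
  have "grid_sum J (\<lambda>i. (midpoint_level V n i)\<^sup>2)
    \<le> grid_sum J (\<lambda>i. 1 / 2 * (V n i)\<^sup>2 + 1 / 2 * (V (Suc n) i)\<^sup>2)"
  proof (rule grid_sum_mono)
    fix i
    show "(midpoint_level V n i)\<^sup>2 \<le> 1 / 2 * (V n i)\<^sup>2 + 1 / 2 * (V (Suc n) i)\<^sup>2"
      using sum_squares_bound[of "V n i" "V (Suc n) i"]
      by (simp add: midpoint_level_def power2_sum power_divide)
  qed
  then show ?thesis unfolding grid_sum_add grid_sum_cmult by (simp add: add_divide_distrib)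
qed

text \<open>The second differences are dropped from the energy identity, and Gronwall is applied
  with \<open>y = k * C\<close>. Since \<open>k * N = T\<close>, the growth factor does not depend
  on the grid.\<close>

lemma crank_nicolson_L2_bound:
  assumes coercive: "\<And>r h J V. r \<in> {\<rho>..P} \<Longrightarrow> V \<in> periodic_grid J \<Longrightarrow>
      c * grid_sum J (\<lambda>i. (discrete_laplacian h V i)\<^sup>2) - C * grid_sum J (\<lambda>i. (V i)\<^sup>2)
        \<le> grid_sum J (\<lambda>i. discrete_operator \<delta> \<alpha> h r V i * V i)"
    and "c \<ge> 0" and "C \<ge> 0" and "T > 0" and "N > 0"
    and R: "\<And>t. t \<in> {0..T} \<Longrightarrow> R t \<in> {\<rho>..P}"
    and small: "time_step T N * C \<le> 1 / 2"
    and sol: "crank_nicolson_solution \<delta> \<alpha> v\<^sub>c T R J N v\<^sub>0 V" and "n \<le> N"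
  shows "grid_sum J (\<lambda>i. (V n i)\<^sup>2) \<le> exp (4 * C * T) * grid_sum J (\<lambda>i. (v\<^sub>0 i)\<^sup>2)"
proof -
  define k where "k = time_step T N"
  have k: "k > 0" using assms by (simp add: k_def time_step_def)
  let ?x = "\<lambda>n. grid_sum J (\<lambda>i. (V n i)\<^sup>2)"
  have x0: "0 \<le> ?x 0" by (rule grid_sum_nonneg) simp
  have "?x (Suc m) - ?x m \<le> (k * C) * (?x m + ?x (Suc m))" if m: "m < N" for m
  proof -
    let ?h = "space_step J" and ?U = "midpoint_level V m"
    have r: "R ((real m + 1/2) * k) \<in> {\<rho>..P}"
      using R[OF midpoint_time_in[OF m assms(4)]] by (simp add: k_def)
    have "0 \<le> c * grid_sum J (\<lambda>i. (discrete_laplacian ?h ?U i)\<^sup>2)"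
      using assms(2) by (intro mult_nonneg_nonneg grid_sum_nonneg) auto
    then have "- grid_sum J (\<lambda>i. discrete_operator \<delta> \<alpha> ?h (R ((real m + 1/2) * k)) ?U i * ?U i)
      \<le> C * grid_sum J (\<lambda>i. (?U i)\<^sup>2)"
      using coercive[OF r crank_nicolson_periodic(2)[OF sol m], of ?h] by linarith
    also have "\<dots> \<le> C * ((?x m + ?x (Suc m)) / 2)"
      using assms(3) by (intro mult_left_mono grid_sum_midpoint_sq_le)
    finally have "2 * k * (- grid_sum J (\<lambda>i. discrete_operator \<delta> \<alpha> ?h (R ((real m + 1/2) * k)) ?U i * ?U i))
      \<le> 2 * k * (C * ((?x m + ?x (Suc m)) / 2))"
      using k by (intro mult_left_mono) auto
    then show ?thesis
      using crank_nicolson_energy[OF sol m assms(4) refl k_def refl] by simp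
  qed
  then have "?x n \<le> exp (4 * (k * C) * real n) * ?x 0"
    using discrete_gronwall_implicit[of N ?x "k * C" n] x0 small k assms(3,9) by (simp add: k_def)
  also have "\<dots> \<le> exp (4 * C * T) * ?x 0"
  proof (rule mult_right_mono[OF _ x0])
    have "k * real n \<le> k * real N" using k assms(9) by (intro mult_left_mono) auto
    also have "\<dots> = T" using assms by (simp add: k_def time_step_def)
    finally have "C * (k * real n) \<le> C * T" using assms(3) by (intro mult_left_mono)
    then show "exp (4 * (k * C) * real n) \<le> exp (4 * C * T)" by (simp add: mult_ac)
  qed
  also have "?x 0 = grid_sum J (\<lambda>i. (v\<^sub>0 i)\<^sup>2)"
    using sol by (simp add: crank_nicolson_solution_def Let_def)
  finally show ?thesis .
qed

section \<open>Uniqueness of a single time step\<close>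

text \<open>After polarisation only the midpoint of \<open>W\<close> remains beside
  \<open>Z\<close>, so the convection estimate is required for \<open>W\<close> alone.
  \<open>\<theta>\<close> bounds the convection coefficient without its factor \<open>1 / h\<close>,
  which is part of that estimate.\<close>

lemma crank_nicolson_unique_step:
  assumes coercive: "\<And>V. V \<in> periodic_grid J \<Longrightarrow>
      c * grid_sum J (\<lambda>i. (discrete_laplacian h V i)\<^sup>2) - C * grid_sum J (\<lambda>i. (V i)\<^sup>2)
        \<le> grid_sum J (\<lambda>i. discrete_operator \<delta> \<alpha> h r V i * V i)"
    and convection: "\<And>Z. Z \<in> periodic_grid J \<Longrightarrow>
      \<bar>grid_sum J (\<lambda>i. discrete_convection Z Z i * midpoint_level W n i)\<bar> / h
        \<le> \<eta> * grid_sum J (\<lambda>i. (discrete_laplacian h Z i)\<^sup>2) + D * grid_sum J (\<lambda>i. (Z i)\<^sup>2)"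
    and \<theta>: "\<bar>v\<^sub>c\<bar> / (6 * r\<^sup>2) \<le> \<theta>" "\<theta> * \<eta> \<le> c" and small: "k * (C + \<theta> * D) \<le> 1"
    and V: "crank_nicolson_solution \<delta> \<alpha> v\<^sub>c T R J N v\<^sub>0 V"
    and W: "crank_nicolson_solution \<delta> \<alpha> v\<^sub>c T R J N v\<^sub>0 W"
    and n: "n < N" and T: "T > 0" and J: "J > 0"
    and h: "h = space_step J" and k: "k = time_step T N" and r: "r = R ((real n + 1/2) * k)"
    and eq: "V n = W n"
  shows "V (Suc n) = W (Suc n)"
proof -
  let ?U = "midpoint_level W n"
  define Z where "Z = (\<lambda>i. midpoint_level V n i - ?U i)"
  have kpos: "k > 0" using n T k by (simp add: time_step_def)
  have hpos: "h > 0" using J h by (simp add: space_step_def)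
  have Zper: "Z \<in> periodic_grid J"
    using crank_nicolson_periodic(2)[OF V n] crank_nicolson_periodic(2)[OF W n]
    by (simp add: Z_def periodic_grid_def)
  have VZ: "midpoint_level V n = (\<lambda>i. ?U i + Z i)" by (simp add: Z_def)
  \<comment> \<open>The factor 2 undoes the averaging in the midpoint, as the two solutions agree at
    level \<open>n\<close>.\<close>
  have Z2: "V (Suc n) i - V n i - (W (Suc n) i - W n i) = 2 * Z i" for i
    using eq by (simp add: Z_def midpoint_level_def field_simps)
  define g where "g = v\<^sub>c / (6 * h * r\<^sup>2)"
  let ?\<Phi> = "\<lambda>i. discrete_convection (\<lambda>i. ?U i + Z i) (\<lambda>i. ?U i + Z i) i - discrete_convection ?U ?U i"
  let ?a = "grid_sum J (\<lambda>i. (Z i)\<^sup>2)" and ?e = "grid_sum J (\<lambda>i. (discrete_laplacian h Z i)\<^sup>2)"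
  let ?\<tau> = "grid_sum J (\<lambda>i. discrete_convection Z Z i * ?U i)"
  have a0: "0 \<le> ?a" and e0: "0 \<le> ?e" by (auto intro: grid_sum_nonneg)
  have pt: "2 / k * (Z i)\<^sup>2 + discrete_operator \<delta> \<alpha> h r Z i * Z i = g * (?\<Phi> i * Z i)" for i
  proof -
    have "1 / k * (V (Suc n) i - V n i) - 1 / k * (W (Suc n) i - W n i) = 1 / k * (2 * Z i)"
      unfolding Z2[symmetric] by (simp only: right_diff_distrib)
    moreover have "discrete_operator \<delta> \<alpha> h r Z i
      = discrete_operator \<delta> \<alpha> h r (midpoint_level V n) i - discrete_operator \<delta> \<alpha> h r ?U i"
      unfolding Z_def by (rule discrete_operator_diff)
    ultimately have "1 / k * (2 * Z i) + discrete_operator \<delta> \<alpha> h r Z i = g * ?\<Phi> i"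
      using crank_nicolson_step[OF V n h k r, of i] crank_nicolson_step[OF W n h k r, of i]
      unfolding VZ[symmetric] g_def right_diff_distrib by linarith
    then have "(1 / k * (2 * Z i) + discrete_operator \<delta> \<alpha> h r Z i) * Z i = g * ?\<Phi> i * Z i" by simp
    then show ?thesis by (simp add: distrib_right power2_eq_square mult.assoc)
  qed
  have "2 / k * ?a + grid_sum J (\<lambda>i. discrete_operator \<delta> \<alpha> h r Z i * Z i)
    = g * grid_sum J (\<lambda>i. ?\<Phi> i * Z i)"
    by (simp only: grid_sum_cmult[symmetric] grid_sum_add[symmetric] pt)
  also have "\<dots> = - (g * ?\<tau>)"
    using discrete_convection_diff_energy[OF Zper crank_nicolson_periodic(2)[OF W n]] by simp
  also have "\<dots> \<le> \<bar>g * ?\<tau>\<bar>" by simp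
  also have "\<dots> = \<bar>v\<^sub>c\<bar> / (6 * r\<^sup>2) * (\<bar>?\<tau>\<bar> / h)"
    using hpos by (simp add: g_def abs_mult)
  also have "\<dots> \<le> \<theta> * (\<bar>?\<tau>\<bar> / h)"
    using \<theta>(1) hpos by (intro mult_right_mono) auto
  also have "\<dots> \<le> \<theta> * (\<eta> * ?e + D * ?a)"
    using \<theta>(1) by (intro mult_left_mono convection[OF Zper]) (auto intro: order_trans[rotated])
  also have "\<dots> \<le> c * ?e + \<theta> * D * ?a"
    using mult_right_mono[OF \<theta>(2) e0] by (simp add: algebra_simps)
  finally have "2 / k * ?a \<le> (C + \<theta> * D) * ?a"
    using coercive[OF Zper] by (simp add: algebra_simps)
  \<comment> \<open>The left side is \<open>2 * ?a\<close> and the right side will be at most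
    \<open>?a\<close>, which forces \<open>?a\<close> to vanish.\<close>
  then have "k * (2 / k * ?a) \<le> k * ((C + \<theta> * D) * ?a)"
    using kpos by (intro mult_left_mono) auto
  also have "\<dots> \<le> 1 * ?a"
    unfolding mult.assoc[symmetric] using small a0 by (intro mult_right_mono)
  finally have a: "?a \<le> 0" using kpos by simp
  have "Z i = 0" for i
  proof -
    have "(Z i)\<^sup>2 \<le> ?a"
      using periodic_grid_map[OF Zper] J by (intro member_le_grid_sum) auto
    with a have "(Z i)\<^sup>2 \<le> 0" by linarith
    then show ?thesis by simp
  qed
  then show ?thesis using Z2 eq by (auto simp: fun_eq_iff)
qed

section \<open>Choice of the constants and induction over the time levels\<close>

theorem proposition3:
  fixes \<delta> \<alpha> v\<^sub>c T R\<^sub>0 M :: real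
    and R :: "real \<Rightarrow> real"
    and v :: "real \<Rightarrow> real \<Rightarrow> real"
  assumes "\<delta> > 0" and "\<alpha> > 0" and "T > 0" and "R\<^sub>0 > 0" and "M > 0"
    and "expanding_radius \<alpha> v\<^sub>c T R\<^sub>0 R"
    and "classically_smooth T v"
    and "\<forall>\<sigma>. \<forall>t\<in>{0..T}. v (\<sigma> + 2 * pi) t = v \<sigma> t"
    and "\<forall>t\<in>{0..T}. integral {0..2 * pi} (\<lambda>\<sigma>. v \<sigma> t) = 0"
    and "solves_pde \<delta> \<alpha> v\<^sub>c T R v"
    and "\<forall>t\<in>{0..T}. \<forall>\<sigma>. \<bar>space_deriv 1 v \<sigma> t\<bar> \<le> M"
  shows "\<exists>\<epsilon>>0. \<forall>J N :: nat. \<forall>v\<^sub>0 V W.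
           J > 0 \<longrightarrow> N > 0 \<longrightarrow>
           time_step T N * space_step J powr (- (1/5)) \<le> \<epsilon> \<longrightarrow>
           v\<^sub>0 = grid_restriction J (\<lambda>\<sigma>. v \<sigma> 0) \<longrightarrow>
           space_step J * (\<Sum>i=1..int J. v\<^sub>0 i) = 0 \<longrightarrow>
           crank_nicolson_solution \<delta> \<alpha> v\<^sub>c T R J N v\<^sub>0 V \<longrightarrow>
           crank_nicolson_solution \<delta> \<alpha> v\<^sub>c T R J N v\<^sub>0 W \<longrightarrow>
           (\<forall>n\<le>N. V n = W n)"
proof -
  note R = assms(6)[unfolded expanding_radius_def]
  \<comment> \<open>Compactness gives positive bounds for the radius, valid at all midpoint times
    and for every \<open>N\<close>.\<close>
  have "continuous_on {0..T} R"
    using R by (intro DERIV_continuous_on) auto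
  moreover have "{0..T} \<noteq> {}" using assms(3) by simp
  ultimately obtain t1 t2 where t1: "t1 \<in> {0..T}" "\<And>t. t \<in> {0..T} \<Longrightarrow> R t1 \<le> R t"
    and t2: "t2 \<in> {0..T}" "\<And>t. t \<in> {0..T} \<Longrightarrow> R t \<le> R t2"
    using continuous_attains_inf[of "{0..T}" R] continuous_attains_sup[of "{0..T}" R] by auto
  define \<rho> P where "\<rho> = R t1" and "P = R t2"
  have \<rho>: "\<rho> > 0" "\<rho> \<le> P" using R t1 t2 by (auto simp: \<rho>_def P_def)
  have Rin: "R t \<in> {\<rho>..P}" if "t \<in> {0..T}" for t
    using t1(2)[OF that] t2(2)[OF that] by (simp add: \<rho>_def P_def)
  obtain c C where c: "c > 0" and C: "C \<ge> 0" and
    coercive: "\<And>r h J V. r \<in> {\<rho>..P} \<Longrightarrow> V \<in> periodic_grid J \<Longrightarrow>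
      c * grid_sum J (\<lambda>i. (discrete_laplacian h V i)\<^sup>2) - C * grid_sum J (\<lambda>i. (V i)\<^sup>2)
        \<le> grid_sum J (\<lambda>i. discrete_operator \<delta> \<alpha> h r V i * V i)"
    using discrete_operator_coercive[OF assms(1) \<rho>, of \<alpha>] by blast
  \<comment> \<open>Continuity at time zero bounds the initial data by a constant \<open>B\<close>
    independent of \<open>J\<close>.\<close>
  have "space_deriv 0 v = v" by (intro ext) (simp add: space_deriv_def)
  then have "continuous_on (UNIV \<times> {0..T}) (\<lambda>(\<sigma>, t). v \<sigma> t)"
    using assms(7)[unfolded classically_smooth_def, THEN conjunct2, THEN conjunct1, rule_format, of 0]
    by simp
  then have "continuous_on {0..2 * pi} ((\<lambda>(\<sigma>, t). v \<sigma> t) \<circ> (\<lambda>\<sigma>. (\<sigma>, 0)))"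
    using assms(3) by (intro continuous_on_compose continuous_intros) (auto elim: continuous_on_subset)
  then have "compact ((\<lambda>\<sigma>. v \<sigma> 0) ` {0..2 * pi})"
    by (intro compact_continuous_image) (auto simp: o_def)
  then obtain B where B: "\<And>\<sigma>. \<sigma> \<in> {0..2 * pi} \<Longrightarrow> \<bar>v \<sigma> 0\<bar> \<le> B"
    using compact_imp_bounded bounded_iff by (metis image_eqI real_norm_def)
  have initial: "space_step J * grid_sum J (\<lambda>i. (grid_restriction J (\<lambda>\<sigma>. v \<sigma> 0) i)\<^sup>2) \<le> 2 * pi * B\<^sup>2"
    if J: "J > 0" for J
  proof -
    have "(grid_restriction J (\<lambda>\<sigma>. v \<sigma> 0) (int m))\<^sup>2 \<le> B\<^sup>2" if "m < J" for m
    proof -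
      have "real m * space_step J \<le> real J * space_step J"
        using that by (intro mult_right_mono) (auto simp: space_step_def)
      also have "\<dots> = 2 * pi" using J by (simp add: space_step_def)
      finally have "\<bar>v (real m * space_step J) 0\<bar> \<le> B" by (intro B) (simp add: space_step_def)
      then have "\<bar>v (real m * space_step J) 0\<bar>\<^sup>2 \<le> B\<^sup>2" by (intro power_mono) auto
      then show ?thesis by (simp add: grid_restriction_def)
    qed
    then have "grid_sum J (\<lambda>i. (grid_restriction J (\<lambda>\<sigma>. v \<sigma> 0) i)\<^sup>2) \<le> (\<Sum>m<J. B\<^sup>2)"
      unfolding grid_sum_def by (intro sum_mono) auto
    then show ?thesis
      using J by (simp add: space_step_def field_simps mult_left_mono)
  qed
  \<comment> \<open>Gronwall factor times the bound for the initial data. \<open>\<theta>\<close> is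
    the convection coefficient at the smallest radius, and the summand 1 in \<open>\<eta>\<close>
    covers the case \<open>\<theta> = 0\<close>.\<close>
  define K where "K = exp (4 * C * T) * (2 * pi * B\<^sup>2)"
  define \<theta> where "\<theta> = \<bar>v\<^sub>c\<bar> / (6 * \<rho>\<^sup>2)"
  define \<eta> where "\<eta> = c / (\<theta> + 1)"
  have \<theta>: "\<theta> \<ge> 0" by (simp add: \<theta>_def)
  then have \<eta>: "\<eta> > 0" "\<theta> * \<eta> \<le> c" using c by (auto simp: \<eta>_def field_simps)
  have "K \<ge> 0" by (simp add: K_def)
  then obtain D where D: "D \<ge> 0" and
    convection: "\<And>J h Z W. J > 0 \<Longrightarrow> h = space_step J \<Longrightarrow> Z \<in> periodic_grid J \<Longrightarrow> W \<in> periodic_grid J \<Longrightarrow>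
      h * grid_sum J (\<lambda>i. (W i)\<^sup>2) \<le> K \<Longrightarrow>
      \<bar>grid_sum J (\<lambda>i. discrete_convection Z Z i * W i)\<bar> / h
        \<le> \<eta> * grid_sum J (\<lambda>i. (discrete_laplacian h Z i)\<^sup>2) + D * grid_sum J (\<lambda>i. (Z i)\<^sup>2)"
    using discrete_convection_bound[OF _ \<eta>(1), of K] by blast
  \<comment> \<open>A step size up to \<open>\<kappa>\<close> satisfies both requirements,
    \<open>k * C \<le> 1 / 2\<close> for Gronwall and \<open>k * (C + \<theta> * D) \<le> 1\<close>
    for the single step. The summand 1 keeps the denominator positive.\<close>
  define \<kappa> where "\<kappa> = 1 / (2 * C + \<theta> * D + 1)"
  have q: "0 < 2 * C + \<theta> * D + 1" using C \<theta> D by (simp add: add_nonneg_pos)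
  then have \<kappa>: "\<kappa> > 0" by (simp add: \<kappa>_def)
  show ?thesis
  \<comment> \<open>As \<open>h \<le> 2 * pi\<close> and the exponent is negative,
    \<open>h powr (- (1/5))\<close> is at least \<open>(2 * pi) powr (- (1/5))\<close>; this
    threshold therefore forces \<open>k \<le> \<kappa>\<close>.\<close>
  proof (intro exI[of _ "\<kappa> * (2 * pi) powr (- (1/5))"] conjI allI impI)
    show "0 < \<kappa> * (2 * pi) powr (- (1/5))" using \<kappa> by simp
  next
    fix J N n :: nat and v\<^sub>0 V W
    assume J: "J > 0" and N: "N > 0"
      and kh: "time_step T N * space_step J powr (- (1/5)) \<le> \<kappa> * (2 * pi) powr (- (1/5))"
      and v0: "v\<^sub>0 = grid_restriction J (\<lambda>\<sigma>. v \<sigma> 0)"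
      and V: "crank_nicolson_solution \<delta> \<alpha> v\<^sub>c T R J N v\<^sub>0 V"
      and W: "crank_nicolson_solution \<delta> \<alpha> v\<^sub>c T R J N v\<^sub>0 W"
      and n: "n \<le> N"
    define h k where "h = space_step J" and "k = time_step T N"
    have k: "k > 0" using assms(3) N by (simp add: k_def time_step_def)
    have h: "0 < h" "h \<le> 2 * pi" using J by (auto simp: h_def space_step_def divide_le_eq)
    have "k * (2 * pi) powr (- (1/5)) \<le> k * h powr (- (1/5))"
      using k h by (intro mult_left_mono powr_mono2') auto
    also have "\<dots> \<le> \<kappa> * (2 * pi) powr (- (1/5))" using kh by (simp add: h_def k_def)
    finally have "k \<le> \<kappa>" by simp
    then have small: "k * (2 * C + \<theta> * D + 1) \<le> 1" using q by (simp add: \<kappa>_def le_divide_eq)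
    moreover have "0 \<le> k * C" "0 \<le> k * (\<theta> * D)" using k C \<theta> D by auto
    ultimately have small1: "k * C \<le> 1 / 2" and small2: "k * (C + \<theta> * D) \<le> 1"
      using k by (simp_all add: algebra_simps)
    have bound: "h * grid_sum J (\<lambda>i. (W m i)\<^sup>2) \<le> K" if "m \<le> N" for m
    proof -
      have "grid_sum J (\<lambda>i. (W m i)\<^sup>2) \<le> exp (4 * C * T) * grid_sum J (\<lambda>i. (v\<^sub>0 i)\<^sup>2)"
        using small1 c by (intro crank_nicolson_L2_bound[OF coercive _ C assms(3) N Rin _ W that])
          (auto simp: k_def)
      then have "h * grid_sum J (\<lambda>i. (W m i)\<^sup>2) \<le> h * (exp (4 * C * T) * grid_sum J (\<lambda>i. (v\<^sub>0 i)\<^sup>2))"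
        using h by (intro mult_left_mono) auto
      also have "\<dots> = exp (4 * C * T) * (h * grid_sum J (\<lambda>i. (v\<^sub>0 i)\<^sup>2))" by simp
      also have "\<dots> \<le> K"
        unfolding K_def h_def v0 using initial[OF J] by (intro mult_left_mono) auto
      finally show ?thesis .
    qed
    show "V n = W n"
      using n
    proof (induction n)
      case 0
      then show ?case using V W by (simp add: crank_nicolson_solution_def Let_def)
    next
      case (Suc n)
      then have n: "n < N" and eq: "V n = W n" by auto
      define r where "r = R ((real n + 1/2) * k)"
      have r: "r \<in> {\<rho>..P}"
        unfolding r_def k_def by (rule Rin[OF midpoint_time_in[OF n assms(3)]])
      have "\<bar>v\<^sub>c\<bar> / (6 * r\<^sup>2) \<le> \<theta>"
        using r \<rho> unfolding \<theta>_def by (auto intro!: divide_left_mono power_mono)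
      \<comment> \<open>By convexity the midpoint inherits the bound from levels \<open>n\<close>
        and \<open>Suc n\<close>, both of which are at most \<open>N\<close>.\<close>
      moreover have "h * grid_sum J (\<lambda>i. (midpoint_level W n i)\<^sup>2) \<le> K"
        using mult_left_mono[OF grid_sum_midpoint_sq_le[of J W n], of h] bound[of n] bound[of "Suc n"] n h
        by (simp add: field_simps)
      ultimately show ?case
        using crank_nicolson_unique_step[OF coercive[OF r]
            convection[OF J h_def _ crank_nicolson_periodic(2)[OF W n]]
            _ \<eta>(2) small2 V W n assms(3) J h_def k_def r_def eq] by blast
    qed
  qed
qed

end
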